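(* Let $I=[0,1]$ and let $x=\sum_{i=1}^k a_i\delta_{t_i}$ be a non-negative $k$-sparse discrete measure with $a_i>0$ and distinct $t_i\in(0,1)$. Let $\sigma>0$, let $m\ge 2k+1$, let $s_1<\dots<s_m$ be points of $I$, and let $\phi_j(t)=e^{-(t-s_j)^2/\sigma^2}$ for $j=1,\dots,m$. Suppose the measurements are exact: $y_j=\int_I\phi_j(t)\,x(dt)$ for $j=1,\dots,m$. Then $x$ is the unique non-negative Borel measure $z$ on $I$ satisfying $\int_I\phi_j(t)\,z(dt)=y_j$ for all $j=1,\dots,m$.
   Context: $\delta_t$ denotes the Dirac measure at $t$. No relation between the points $s_j$ and $t_i$, and no minimum separation of the $t_i$, is assumed. *)

theory Defs
  imports "HOL-Probability.Giry_Monad"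
begin

abbreviation borel_I :: "real measure" where
  "borel_I \<equiv> restrict_space borel {0..1}"

text \<open>The type of measures carries no addition, so the sum of the weighted Dirac measures
  is formed setwise on the Borel sets of the unit interval.\<close>

definition discrete_measure :: "nat \<Rightarrow> (nat \<Rightarrow> real) \<Rightarrow> (nat \<Rightarrow> real) \<Rightarrow> real measure" where
  "discrete_measure k a t =
     measure_of (space borel_I) (sets borel_I)
       (\<lambda>A. \<Sum>i = 1..k. ennreal (a i) * emeasure (return borel_I (t i)) A)"

lemma sets_discrete_measure [simp]: "sets (discrete_measure k a t) = sets borel_I"
  unfolding discrete_measure_def by (rule sets.sets_measure_of_eq)

lemma space_discrete_measure [simp]: "space (discrete_measure k a t) = {0..1}"
  using sets_eq_imp_space_eq[OF sets_discrete_measure] by (simp add: space_restrict_space)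

lemma emeasure_discrete_measure:
  assumes "A \<in> sets borel_I"
  shows "emeasure (discrete_measure k a t) A = (\<Sum>i = 1..k. ennreal (a i) * indicator A (t i))"
proof -
  have "emeasure (discrete_measure k a t) A =
      (\<Sum>i = 1..k. ennreal (a i) * emeasure (return borel_I (t i)) A)"
    unfolding discrete_measure_def
  proof (rule emeasure_measure_of_sigma)
    show "sigma_algebra (space borel_I) (sets borel_I)"
      by (rule sets.sigma_algebra_axioms)
    show "positive (sets borel_I)
        (\<lambda>A. \<Sum>i = 1..k. ennreal (a i) * emeasure (return borel_I (t i)) A)"
      by (simp add: positive_def)
    show "countably_additive (sets borel_I)
        (\<lambda>A. \<Sum>i = 1..k. ennreal (a i) * emeasure (return borel_I (t i)) A)"
    proof (rule countably_additiveI)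
      fix B :: "nat \<Rightarrow> real set"
      assume B: "range B \<subseteq> sets borel_I" "disjoint_family B" "\<Union> (range B) \<in> sets borel_I"
      have "(\<Sum>n. \<Sum>i = 1..k. ennreal (a i) * emeasure (return borel_I (t i)) (B n)) =
          (\<Sum>i = 1..k. \<Sum>n. ennreal (a i) * emeasure (return borel_I (t i)) (B n))"
        by (rule suminf_sum) simp
      also have "\<dots> = (\<Sum>i = 1..k. ennreal (a i) * emeasure (return borel_I (t i)) (\<Union> (range B)))"
      proof (rule sum.cong[OF refl])
        fix i
        have "(\<Sum>n. emeasure (return borel_I (t i)) (B n)) =
            emeasure (return borel_I (t i)) (\<Union> (range B))"
          by (rule suminf_emeasure) (use B in \<open>simp_all only: sets_return\<close>)
        then show "(\<Sum>n. ennreal (a i) * emeasure (return borel_I (t i)) (B n)) =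
            ennreal (a i) * emeasure (return borel_I (t i)) (\<Union> (range B))"
          by simp
      qed
      finally show "(\<Sum>n. \<Sum>i = 1..k. ennreal (a i) * emeasure (return borel_I (t i)) (B n)) =
          (\<Sum>i = 1..k. ennreal (a i) * emeasure (return borel_I (t i)) (\<Union> (range B)))" .
    qed
  qed (rule assms)
  then show ?thesis
    using assms by simp
qed

definition gauss_kernel :: "real \<Rightarrow> real \<Rightarrow> real \<Rightarrow> real" where
  "gauss_kernel \<sigma> c u = exp (- (u - c)\<^sup>2 / \<sigma>\<^sup>2)"

text \<open>The measure \<open>z\<close> is not required to be finite. Using \<^const>\<open>has_bochner_integral\<close> instead of
  an equation between integrals matters, since the Bochner integral of a non-integrable
  function is 0 by convention.\<close>

definition fits_measurements ::
    "real \<Rightarrow> nat \<Rightarrow> (nat \<Rightarrow> real) \<Rightarrow> (nat \<Rightarrow> real) \<Rightarrow> real measure \<Rightarrow> bool" where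
  "fits_measurements \<sigma> m s y z \<longleftrightarrow>
     sets z = sets borel_I \<and>
     (\<forall>j\<in>{1..m}. has_bochner_integral z (gauss_kernel \<sigma> (s j)) (y j))"

end

theory Submission imports Defs begin

text \<open>
  The proof is the dual certificate argument. Suppose some linear combination
  \<open>F = (\<Sum>j. b j * \<phi> j)\<close> of the kernels is non-negative and has exactly the points \<open>t i\<close> as
  its zeros. Any non-negative \<open>z\<close> with the same measurements as \<open>x\<close> satisfies
  \<open>\<integral>F dz = (\<Sum>j. b j * y j) = \<integral>F dx = 0\<close>, hence \<open>z\<close> lives on the points \<open>t i\<close>. To compare
  weights, take for each \<open>r\<close> a combination \<open>G\<close> that vanishes at all \<open>t i\<close> except \<open>t r\<close>:
  equality of \<open>\<integral>G\<close> for both measures is equality of their masses at \<open>t r\<close>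
  (\<open>nonneg_measure_unique_from_gauss_integrals\<close>).

  Both combinations come from a zero count. Expanding the square shows that a kernel with
  centre \<open>s\<close> is a constant times \<open>exp (- u\<^sup>2 / \<sigma>\<^sup>2)\<close> times \<open>exp (l * u)\<close> with
  \<open>l = 2 * s / \<sigma>\<^sup>2\<close>, so up to a positive factor combinations of kernels are exponential sums.
  A nonzero exponential sum with \<open>n\<close> exponents has fewer than \<open>n\<close> zeros counted with
  multiplicity (\<open>exp_sum_zero_count\<close>). Double zeros at \<open>k\<close> points are \<open>2 * k\<close> linear equations,
  which \<open>2 * k + 1\<close> coefficients can satisfy nontrivially; the zero count then leaves room neither
  for another zero nor for a zero of order three. So the second derivative is nonzero at
  each zero, the sum does not change sign anywhere, and it or its negative is the certificate
  (\<open>exp_sum_certificate\<close>).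
\<close>

section \<open>Homogeneous linear systems\<close>

text \<open>Gaussian elimination of one unknown per equation; the index sets are arbitrary so that
  the equations can later be indexed by pairs of a zero and a derivative order.\<close>

lemma homogeneous_system_nontrivial_solution:
  fixes v :: "'i \<Rightarrow> 'j \<Rightarrow> 'a::field"
  assumes "finite I" "finite J" "card I < card J"
  shows "\<exists>c. (\<exists>j\<in>J. c j \<noteq> 0) \<and> (\<forall>i\<in>I. (\<Sum>j\<in>J. c j * v i j) = 0)"
  using assms
proof (induction I arbitrary: J v rule: finite_induct)
  case empty
  then obtain j where "j \<in> J" by fastforce
  then show ?case by (intro exI[of _ "\<lambda>_. 1"]) auto
next
  case (insert r I)
  show ?case
  proof (cases "\<forall>j\<in>J. v r j = 0")
    case True
    with insert.IH[of J v] insert.prems insert.hyps show ?thesis by auto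
  next
    case False
    then obtain p where p: "p \<in> J" "v r p \<noteq> 0" by blast
    \<comment> \<open>The remaining equations after equation \<open>r\<close> has been used to eliminate the unknown \<open>p\<close>.\<close>
    define w where "w i j = v i j - v i p * v r j / v r p" for i j
    have "card I < card (J - {p})"
      using insert.prems insert.hyps p by simp
    from insert.IH[of "J - {p}" w, OF _ this] insert.prems obtain c where
      c: "\<exists>j\<in>J - {p}. c j \<noteq> 0" "\<forall>i\<in>I. (\<Sum>j\<in>J - {p}. c j * w i j) = 0"
      by auto
    define q where "q = - (\<Sum>j\<in>J - {p}. c j * v r j) / v r p"
    have split: "(\<Sum>j\<in>J. (c(p := q)) j * v i j) = q * v i p + (\<Sum>j\<in>J - {p}. c j * v i j)" for i
      using insert.prems p by (subst sum.remove[of _ p]) (auto intro!: sum.cong)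
    have "(\<Sum>j\<in>J. (c(p := q)) j * v i j) = 0" if "i \<in> insert r I" for i
    proof (cases "i = r")
      case True
      then show ?thesis unfolding split using p by (simp add: q_def)
    next
      case False
      have "(\<Sum>j\<in>J - {p}. c j * w i j)
          = (\<Sum>j\<in>J - {p}. c j * v i j) - v i p / v r p * (\<Sum>j\<in>J - {p}. c j * v r j)"
        unfolding w_def sum_distrib_left sum_subtractf[symmetric]
        by (rule sum.cong) (auto simp: field_simps)
      moreover have "(\<Sum>j\<in>J - {p}. c j * w i j) = 0" using c(2) that False by auto
      ultimately show ?thesis unfolding split by (simp add: q_def field_simps)
    qed
    moreover have "\<exists>j\<in>J. (c(p := q)) j \<noteq> 0" using c(1) by auto
    ultimately show ?thesis by blast
  qed
qed

section \<open>Zeros of exponential sums\<close>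

definition exp_sum :: "real set \<Rightarrow> (real \<Rightarrow> real) \<Rightarrow> real \<Rightarrow> real" where
  "exp_sum L c u = (\<Sum>l\<in>L. c l * exp (l * u))"

text \<open>Multiplying the coefficient of each exponent \<open>l\<close> by \<open>l ^ i\<close> is taking the \<open>i\<close>-th derivative.
  Writing derivatives in this form makes vanishing to a given order a condition that is
  linear in the coefficients.\<close>

definition vanishes_to_order :: "real set \<Rightarrow> (real \<Rightarrow> real) \<Rightarrow> real \<Rightarrow> nat \<Rightarrow> bool" where
  "vanishes_to_order L c z n \<longleftrightarrow> (\<forall>i<n. exp_sum L (\<lambda>l. c l * l ^ i) z = 0)"

lemma DERIV_exp_sum: "(exp_sum L c has_real_derivative exp_sum L (\<lambda>l. c l * l) u) (at u)"
  unfolding exp_sum_def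
  by (auto intro!: derivative_eq_intros sum.cong simp: algebra_simps)

text \<open>The purpose of the factor \<open>exp (- p * u)\<close> is that the derivative loses the exponent \<open>p\<close>,
  whose coefficient becomes 0, while the zeros of the sum stay where they are.\<close>

lemma DERIV_exp_sum_tilted:
  "((\<lambda>u. exp (- p * u) * exp_sum L c u) has_real_derivative
     exp (- p * u) * exp_sum L (\<lambda>l. c l * (l - p)) u) (at u)"
proof -
  have "exp_sum L (\<lambda>l. c l * (l - p)) u = exp_sum L (\<lambda>l. c l * l) u - p * exp_sum L c u"
    unfolding exp_sum_def sum_distrib_left sum_subtractf[symmetric]
    by (rule sum.cong) (auto simp: algebra_simps)
  then show ?thesis
    by (simp only:) (auto intro!: derivative_eq_intros DERIV_exp_sum simp: algebra_simps)
qed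

text \<open>One new zero of the derivative lies strictly between any two consecutive zeros. That it
  avoids \<open>Z\<close> is what allows these zeros to be counted in addition to the multiple zeros of \<open>f\<close>.
  The bound by \<open>Max Z\<close> keeps points apart when \<open>Z\<close> is extended to the right.\<close>

lemma Rolle_finite_zero_set:
  fixes f f' :: "real \<Rightarrow> real"
  assumes deriv: "\<And>u. (f has_real_derivative f' u) (at u)"
    and "finite Z" "\<forall>z\<in>Z. f z = 0" "Z \<noteq> {}"
  shows "\<exists>W. finite W \<and> card Z = Suc (card W) \<and> W \<inter> Z = {} \<and>
           (\<forall>w\<in>W. f' w = 0 \<and> w \<le> Max Z)"
  using assms(2-)
proof (induction Z rule: finite_linorder_max_induct)
  case empty
  then show ?case by simp
next
  case (insert b A)
  show ?case
  proof (cases "A = {}")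
    case True
    then show ?thesis by (intro exI[of _ "{}"]) auto
  next
    case False
    with insert obtain W where W: "finite W" "card A = Suc (card W)" "W \<inter> A = {}"
        "\<forall>w\<in>W. f' w = 0 \<and> w \<le> Max A" by auto
    have Max: "Max A \<in> A" "Max A < b" using insert False by auto
    have "\<exists>w>Max A. w < b \<and> (f has_real_derivative 0) (at w)"
    proof (rule Rolle)
      show "continuous_on {Max A..b} f"
        by (rule DERIV_continuous_on) (rule DERIV_subset[OF deriv], simp)
    qed (use Max insert.prems deriv in \<open>auto simp: real_differentiable_def\<close>)
    then obtain w where w: "Max A < w" "w < b" "f' w = 0"
      using DERIV_unique[OF deriv] by blast
    have "w \<notin> W" using W(4) w(1) by force
    moreover have "w \<notin> A" using w(1) Max_ge[OF insert.hyps(1)] by force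
    moreover have "b \<notin> W" using W(4) Max(2) by force
    moreover have "b \<notin> A" using insert.hyps by auto
    moreover have "Max (insert b A) = b" using insert.hyps False Max by (simp add: Max_insert)
    ultimately show ?thesis using W w Max insert.hyps
      by (intro exI[of _ "insert w W"]) auto
  qed
qed

text \<open>Induction on the number of exponents: remove the exponent \<open>p\<close> by tilting and differentiating.
  Every zero loses one from its multiplicity, which costs \<open>card Z\<close>, and Rolle's theorem gives
  \<open>card Z - 1\<close> new zeros. So the total multiplicity drops by at most one while the
  number of exponents drops by exactly one.\<close>

theorem exp_sum_zero_count:
  fixes L Z :: "real set" and c :: "real \<Rightarrow> real" and \<mu> :: "real \<Rightarrow> nat"
  assumes "finite L" "finite Z" "\<exists>l\<in>L. c l \<noteq> 0"
    and "\<And>z. z \<in> Z \<Longrightarrow> \<mu> z > 0"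
    and "\<And>z. z \<in> Z \<Longrightarrow> vanishes_to_order L c z (\<mu> z)"
  shows "(\<Sum>z\<in>Z. \<mu> z) < card L"
  using assms
proof (induction "card L" arbitrary: L Z c \<mu>)
  case 0
  then show ?case by auto
next
  case (Suc n)
  have zero: "exp_sum L c z = 0" if "z \<in> Z" for z
    using Suc.prems(4,5)[OF that] by (auto simp: vanishes_to_order_def)
  obtain p where p: "p \<in> L" using Suc.prems(3) by auto
  define d where "d l = c l * (l - p)" for l
  have drop_p: "exp_sum (L - {p}) (\<lambda>l. d l * l ^ i) u = exp_sum L (\<lambda>l. d l * l ^ i) u" for i u
    unfolding exp_sum_def d_def using Suc.prems(1) p by (subst (2) sum.remove[of _ p]) auto
  consider "Z = {}" | "\<forall>l\<in>L - {p}. c l = 0" "Z \<noteq> {}" | "\<exists>l\<in>L - {p}. c l \<noteq> 0" "Z \<noteq> {}"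
    by blast
  then show ?case
  proof cases
    case 1
    then show ?thesis using Suc.hyps(2) by simp
  next
    case 2
    then obtain z where z: "z \<in> Z" by blast
    have "exp_sum L c z = c p * exp (p * z)"
      unfolding exp_sum_def using Suc.prems(1) p 2 by (subst sum.remove[of _ p]) auto
    moreover have "c p \<noteq> 0" using Suc.prems(3) 2 by auto
    ultimately show ?thesis using zero[OF z] by simp
  next
    case 3
    obtain W where W: "finite W" "card Z = Suc (card W)" "W \<inter> Z = {}"
        "\<And>w. w \<in> W \<Longrightarrow> exp_sum L d w = 0"
      using Rolle_finite_zero_set[OF DERIV_exp_sum_tilted[of p L c] Suc.prems(2)] zero 3(2)
      unfolding d_def by auto
    \<comment> \<open>Zeros of the tilted derivative: the multiple zeros of the sum and the Rolle points.\<close>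
    define Z2 where "Z2 = {z \<in> Z. \<mu> z > 1}"
    define \<nu> where "\<nu> z = (if z \<in> W then 1 else \<mu> z - 1)" for z
    have fin: "finite Z2" "finite (Z2 \<union> W)" and sub: "Z2 \<subseteq> Z"
      using Suc.prems(2) W by (auto simp: Z2_def)
    have "(\<Sum>z\<in>Z2 \<union> W. \<nu> z) < card (L - {p})"
    proof (rule Suc.hyps(1))
      show "n = card (L - {p})" using Suc.hyps(2) p Suc.prems(1) by simp
      show "\<exists>l\<in>L - {p}. d l \<noteq> 0" using 3 by (auto simp: d_def)
      show "\<nu> z > 0" if "z \<in> Z2 \<union> W" for z using that by (auto simp: \<nu>_def Z2_def)
      show "vanishes_to_order (L - {p}) d z (\<nu> z)" if z: "z \<in> Z2 \<union> W" for z
      proof (cases "z \<in> W")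
        case True
        then show ?thesis
          using W(4) drop_p[of 0] by (simp add: vanishes_to_order_def \<nu>_def)
      next
        case False
        have "exp_sum L (\<lambda>l. d l * l ^ i) z = 0" if "i < \<mu> z - 1" for i
        proof -
          \<comment> \<open>The tilted derivative differs from the \<open>(i+1)\<close>-st derivative by \<open>p\<close> times the \<open>i\<close>-th.\<close>
          have "exp_sum L (\<lambda>l. d l * l ^ i) z
              = exp_sum L (\<lambda>l. c l * l ^ Suc i) z - p * exp_sum L (\<lambda>l. c l * l ^ i) z"
            unfolding exp_sum_def d_def sum_distrib_left sum_subtractf[symmetric]
            by (rule sum.cong) (auto simp: algebra_simps)
          moreover have "vanishes_to_order L c z (\<mu> z)"
            using z False sub by (intro Suc.prems(5)) auto
          ultimately show ?thesis
            using that unfolding vanishes_to_order_def by (auto simp del: power_Suc)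
        qed
        then show ?thesis using False drop_p by (simp add: vanishes_to_order_def \<nu>_def)
      qed
    qed (use Suc.prems fin in auto)
    moreover have "(\<Sum>z\<in>Z2 \<union> W. \<nu> z) = (\<Sum>z\<in>Z2. \<nu> z) + (\<Sum>z\<in>W. \<nu> z)"
      using fin W sub by (intro sum.union_disjoint) auto
    moreover have "(\<Sum>z\<in>W. \<nu> z) = card W" by (simp add: \<nu>_def)
    moreover have "(\<Sum>z\<in>Z2. \<nu> z) = (\<Sum>z\<in>Z. \<mu> z - 1)"
      using Suc.prems(2) W(3) sub by (intro sum.mono_neutral_cong_left) (auto simp: Z2_def \<nu>_def)
    moreover have "(\<Sum>z\<in>Z. \<mu> z) = (\<Sum>z\<in>Z. \<mu> z - 1) + card Z"
    proof -
      have "(\<Sum>z\<in>Z. \<mu> z) = (\<Sum>z\<in>Z. (\<mu> z - 1) + 1)"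
        using Suc.prems(4) by (intro sum.cong) (auto simp: Suc_leI)
      then show ?thesis by (simp only: sum.distrib) simp
    qed
    ultimately show ?thesis using W(2) p Suc.prems(1) Suc.hyps(2) by simp
  qed
qed

text \<open>Each unit of multiplicity is one homogeneous linear equation for the coefficients, so
  fewer equations than exponents leave a nontrivial solution.\<close>

lemma exp_sum_with_prescribed_zeros:
  fixes L Z :: "real set" and \<mu> :: "real \<Rightarrow> nat"
  assumes "finite L" "finite Z" "(\<Sum>z\<in>Z. \<mu> z) < card L"
  obtains c where "\<exists>l\<in>L. c l \<noteq> 0" "\<And>z. z \<in> Z \<Longrightarrow> vanishes_to_order L c z (\<mu> z)"
proof -
  let ?I = "Sigma Z (\<lambda>z. {..<\<mu> z})"
  have "card ?I = (\<Sum>z\<in>Z. \<mu> z)" using assms by (subst card_SigmaI) auto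
  then have "\<exists>c. (\<exists>l\<in>L. c l \<noteq> 0) \<and>
      (\<forall>zi\<in>?I. (\<Sum>l\<in>L. c l * (l ^ snd zi * exp (l * fst zi))) = 0)"
    using assms by (intro homogeneous_system_nontrivial_solution) auto
  then obtain c where c: "\<exists>l\<in>L. c l \<noteq> 0"
      "\<forall>zi\<in>?I. (\<Sum>l\<in>L. c l * (l ^ snd zi * exp (l * fst zi))) = 0"
    by blast
  show thesis
  proof (rule that[OF c(1)])
    fix z assume "z \<in> Z"
    then show "vanishes_to_order L c z (\<mu> z)"
      using c(2) by (force simp: vanishes_to_order_def exp_sum_def mult.assoc)
  qed
qed

section \<open>The dual certificate\<close>

lemma second_derivative_positive_near_double_zero:
  fixes f f' :: "real \<Rightarrow> real"
  assumes f: "\<And>u. (f has_real_derivative f' u) (at u)"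
    and f': "(f' has_real_derivative D) (at z)" "D > 0"
    and z: "f z = 0" "f' z = 0"
  shows "\<forall>\<^sub>F u in at z. f u > 0"
proof -
  obtain d1 where d1: "d1 > 0" "\<And>h. 0 < h \<Longrightarrow> h < d1 \<Longrightarrow> f' (z + h) > 0"
    using has_real_derivative_pos_inc_right[of f' D z UNIV] f' z by auto
  obtain d2 where d2: "d2 > 0" "\<And>h. 0 < h \<Longrightarrow> h < d2 \<Longrightarrow> f' (z - h) < 0"
    using has_real_derivative_pos_inc_left[of f' D z UNIV] f' z by auto
  have "f u > 0" if u: "u \<noteq> z" "dist u z < min d1 d2" for u
  proof (cases "u > z")
    case True
    obtain w where w: "z < w" "w < u" "f u - f z = (u - z) * f' w"
      using MVT2[OF True] f by blast
    have "f' w > 0" using d1(2)[of "w - z"] w u True by (simp add: dist_real_def)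
    with w z True show ?thesis by simp
  next
    case False
    then have lt: "u < z" using u by simp
    obtain w where w: "u < w" "w < z" "f z - f u = (z - u) * f' w"
      using MVT2[OF lt] f by blast
    have "f' w < 0" using d2(2)[of "z - w"] w u lt by (simp add: dist_real_def)
    then have "(z - u) * f' w < 0" using lt by (intro mult_pos_neg) auto
    with w z show ?thesis by simp
  qed
  then show ?thesis unfolding eventually_at using d1(1) d2(1)
    by (intro exI[of _ "min d1 d2"]) auto
qed

text \<open>Punctured neighbourhoods allow \<open>f\<close> to vanish at \<open>z\<close> itself. The points around which \<open>f\<close>
  is positive and those around which it is negative form two disjoint open sets covering a
  connected space, so one of them is empty.\<close>

lemma constant_sign_if_locally_constant_sign:
  fixes f :: "'a::{perfect_space,real_normed_vector} \<Rightarrow> real"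
  assumes "\<And>z. (\<forall>\<^sub>F u in at z. f u > 0) \<or> (\<forall>\<^sub>F u in at z. f u < 0)"
  shows "(\<forall>z. \<forall>\<^sub>F u in at z. f u > 0) \<or> (\<forall>z. \<forall>\<^sub>F u in at z. f u < 0)"
proof -
  have op: "open {z. \<forall>\<^sub>F u in at z. P u}" for P :: "'a \<Rightarrow> bool"
  proof (subst open_subopen, intro ballI)
    fix z assume "z \<in> {z. \<forall>\<^sub>F u in at z. P u}"
    then obtain S where S: "open S" "z \<in> S" "\<forall>u\<in>S. u \<noteq> z \<longrightarrow> P u"
      by (auto simp: eventually_at_topological)
    have "\<forall>\<^sub>F u in at y. P u" if "y \<in> S" for y
    proof (cases "y = z")
      case True
      then show ?thesis using S by (auto simp: eventually_at_topological)
    next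
      case False
      then show ?thesis unfolding eventually_at_topological
        using S that by (intro exI[of _ "S - {z}"]) (auto intro: open_delete)
    qed
    with S show "\<exists>T. open T \<and> z \<in> T \<and> T \<subseteq> {z. \<forall>\<^sub>F u in at z. P u}" by blast
  qed
  let ?A = "{z. \<forall>\<^sub>F u in at z. f u > 0}" and ?B = "{z. \<forall>\<^sub>F u in at z. f u < 0}"
  have disj: "?A \<inter> ?B = {}"
  proof -
    have False if "\<forall>\<^sub>F u in at z. f u > 0" "\<forall>\<^sub>F u in at z. f u < 0" for z
    proof -
      have "\<forall>\<^sub>F u in at z. False" using that by eventually_elim auto
      then show False by (simp add: trivial_limit_def[symmetric])
    qed
    then show ?thesis by blast
  qed
  have "?A = {} \<or> ?B = {}"
    using connectedD[OF connected_UNIV op[of "\<lambda>u. f u > 0"] op[of "\<lambda>u. f u < 0"]] assms disj by auto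
  then show ?thesis using assms by blast
qed

text \<open>The \<open>2 * card T\<close> equations for double zeros use up everything that the zero count
  permits. A zero outside \<open>T\<close>, or a vanishing second derivative at a point of \<open>T\<close>, would be one
  zero too many. Hence every zero is a strict local extremum, and the sum keeps its sign
  when passing through it; the sign itself is free, because the coefficients may be negated.\<close>

lemma exp_sum_certificate:
  fixes L T :: "real set"
  assumes "finite L" "finite T" "card L = 2 * card T + 1"
  obtains c where "\<And>u. exp_sum L c u \<ge> 0" "\<And>u. exp_sum L c u = 0 \<longleftrightarrow> u \<in> T"
proof -
  obtain c where nontriv: "\<exists>l\<in>L. c l \<noteq> 0"
    and double: "\<And>z. z \<in> T \<Longrightarrow> vanishes_to_order L c z 2"
    using exp_sum_with_prescribed_zeros[of L T "\<lambda>_. 2"] assms by auto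
  let ?E = "exp_sum L c" and ?E1 = "exp_sum L (\<lambda>l. c l * l)"
  let ?E2 = "exp_sum L (\<lambda>l. c l * l * l)"
  have E: "?E z = 0" and E1: "?E1 z = 0" if "z \<in> T" for z
    using double[OF that] unfolding vanishes_to_order_def
    by (auto dest: spec[of _ 0] spec[of _ 1])
  have zeros: "?E u = 0 \<longleftrightarrow> u \<in> T" for u
  proof (rule iffI; rule ccontr)
    assume u: "?E u = 0" "u \<notin> T"
    have "(\<Sum>z\<in>insert u T. if z = u then 1 else 2) < card L"
      using assms nontriv double u
      by (intro exp_sum_zero_count[where c = c]) (auto simp: vanishes_to_order_def)
    moreover have "(\<Sum>z\<in>T. if z = u then 1 else 2::nat) = (\<Sum>z\<in>T. 2)"
      using u by (intro sum.cong) auto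
    ultimately show False using u assms by simp
  qed (use E in auto)
  have E2: "?E2 z \<noteq> 0" if z: "z \<in> T" for z
  proof
    assume "?E2 z = 0"
    with E[OF z] E1[OF z] have triple: "vanishes_to_order L c z 3"
      by (auto simp: vanishes_to_order_def numeral_3_eq_3 less_Suc_eq mult.assoc)
    have "(\<Sum>y\<in>T. if y = z then 3 else 2) < card L"
      using assms nontriv double triple
      by (intro exp_sum_zero_count[where c = c]) auto
    moreover have "(\<Sum>y\<in>T. if y = z then 3 else 2::nat) = 3 + (\<Sum>y\<in>T - {z}. 2)"
      using z assms(2) by (subst sum.remove[of _ z]) (auto intro!: sum.cong)
    moreover have "card T > 0" using z assms(2) by (auto simp: card_gt_0_iff)
    ultimately show False using z assms by simp
  qed
  have local_sign: "(\<forall>\<^sub>F u in at z. ?E u > 0) \<or> (\<forall>\<^sub>F u in at z. ?E u < 0)" for z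
  proof (cases "z \<in> T")
    case True
    note d = DERIV_exp_sum[of L c] DERIV_exp_sum[of L "\<lambda>l. c l * l" z]
    show ?thesis
    proof (cases "?E2 z > 0")
      case True
      with second_derivative_positive_near_double_zero[OF d] E E1 \<open>z \<in> T\<close> show ?thesis by blast
    next
      case False
      then have "- ?E2 z > 0" using E2[OF \<open>z \<in> T\<close>] by simp
      from second_derivative_positive_near_double_zero[OF DERIV_minus[OF d(1)] DERIV_minus[OF d(2)] this]
      show ?thesis using E E1 \<open>z \<in> T\<close> by simp
    qed
  next
    case False
    then have "?E z \<noteq> 0" using zeros by simp
    moreover have "(?E \<longlongrightarrow> ?E z) (at z)"
      using DERIV_isCont[OF DERIV_exp_sum[of L c z]] by (simp add: isCont_def)
    ultimately show ?thesis
      using order_tendstoD[of ?E "?E z" "at z"] by (metis linorder_neqE_linordered_idom)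
  qed
  have nonneg: "g u \<ge> 0"
    if "\<forall>\<^sub>F u in at u. g u > 0" "isCont g u" for g :: "real \<Rightarrow> real" and u
    using that by (intro tendsto_lowerbound[of g "g u" "at u"])
      (auto simp: isCont_def elim: eventually_mono)
  have neg: "exp_sum L (\<lambda>l. - c l) u = - ?E u" for u by (simp add: exp_sum_def sum_negf)
  have cont: "isCont ?E u" for u by (rule DERIV_isCont[OF DERIV_exp_sum])
  from constant_sign_if_locally_constant_sign[OF local_sign] show thesis
  proof
    assume "\<forall>z. \<forall>\<^sub>F u in at z. ?E u > 0"
    then show thesis using nonneg[of ?E] cont zeros by (intro that[of c]) auto
  next
    assume *: "\<forall>z. \<forall>\<^sub>F u in at z. ?E u < 0"
    have "- ?E u \<ge> 0" for u using * cont by (intro nonneg[of "\<lambda>u. - ?E u"]) auto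
    then show thesis using zeros by (intro that[of "\<lambda>l. - c l"]) (simp_all add: neg)
  qed
qed

section \<open>Gaussian combinations\<close>

text \<open>Expanding \<open>(u - s)\<^sup>2\<close> separates a kernel into a factor common to all centres, a constant
  depending on the centre, and an exponential in \<open>u\<close>. The constant is absorbed in the coefficient,
  the common factor affects neither zeros nor signs.\<close>

lemma exp_sum_eq_gauss_sum:
  fixes S :: "real set" and c :: "real \<Rightarrow> real"
  assumes "\<sigma> > 0"
  shows "(\<Sum>s\<in>S. c (2 * s / \<sigma>\<^sup>2) * exp (s\<^sup>2 / \<sigma>\<^sup>2) * gauss_kernel \<sigma> s u)
       = exp (- u\<^sup>2 / \<sigma>\<^sup>2) * exp_sum ((\<lambda>s. 2 * s / \<sigma>\<^sup>2) ` S) c u"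
proof -
  have "inj_on (\<lambda>s. 2 * s / \<sigma>\<^sup>2) S" using assms by (auto simp: inj_on_def)
  moreover have "exp (s\<^sup>2 / \<sigma>\<^sup>2) * gauss_kernel \<sigma> s u = exp (- u\<^sup>2 / \<sigma>\<^sup>2) * exp (2 * s / \<sigma>\<^sup>2 * u)" for s
    using assms unfolding gauss_kernel_def exp_add[symmetric]
    by (simp add: field_simps power2_eq_square)
  ultimately show ?thesis
    by (simp add: exp_sum_def sum.reindex sum_distrib_left mult.assoc mult.left_commute)
qed

lemma card_gauss_exponents:
  "\<sigma> > 0 \<Longrightarrow> card ((\<lambda>s. 2 * s / \<sigma>\<^sup>2) ` S) = card (S :: real set)"
  by (intro card_image) (auto simp: inj_on_def)

text \<open>With more than \<open>2 * card T + 1\<close> terms the zero count would leave room for further zeros, so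
  surplus centres get the coefficient 0.\<close>

lemma gauss_certificate:
  fixes S T :: "real set"
  assumes "\<sigma> > 0" "finite S" "finite T" "card S \<ge> 2 * card T + 1"
  obtains b where "\<And>u. (\<Sum>s\<in>S. b s * gauss_kernel \<sigma> s u) \<ge> 0"
    "\<And>u. (\<Sum>s\<in>S. b s * gauss_kernel \<sigma> s u) = 0 \<longleftrightarrow> u \<in> T"
proof -
  obtain R where R: "R \<subseteq> S" "card R = 2 * card T + 1" "finite R"
    using obtain_subset_with_card_n[OF assms(4)] by metis
  let ?L = "(\<lambda>s. 2 * s / \<sigma>\<^sup>2) ` R"
  obtain c where c: "\<And>u. exp_sum ?L c u \<ge> 0" "\<And>u. exp_sum ?L c u = 0 \<longleftrightarrow> u \<in> T"
    using exp_sum_certificate[of ?L T] R assms card_gauss_exponents[of \<sigma> R] by auto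
  let ?b = "\<lambda>s. if s \<in> R then c (2 * s / \<sigma>\<^sup>2) * exp (s\<^sup>2 / \<sigma>\<^sup>2) else 0"
  have "(\<Sum>s\<in>S. ?b s * gauss_kernel \<sigma> s u) = exp (- u\<^sup>2 / \<sigma>\<^sup>2) * exp_sum ?L c u" for u
    unfolding exp_sum_eq_gauss_sum[OF assms(1), symmetric]
    using R assms(2) by (intro sum.mono_neutral_cong_right) auto
  with c show thesis by (intro that[of ?b]) simp_all
qed

text \<open>With only \<open>card T\<close> terms, the \<open>card T - 1\<close> prescribed simple zeros are all the zeros the sum
  can have, so it cannot vanish at \<open>r\<close> as well.\<close>

lemma gauss_separates_points:
  fixes S T :: "real set"
  assumes "\<sigma> > 0" "finite S" "finite T" "card S \<ge> card T" "r \<in> T"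
  obtains b where "\<And>u. u \<in> T \<Longrightarrow> (\<Sum>s\<in>S. b s * gauss_kernel \<sigma> s u) = 0 \<longleftrightarrow> u \<noteq> r"
proof -
  obtain R where R: "R \<subseteq> S" "card R = card T" "finite R"
    using obtain_subset_with_card_n[OF assms(4)] by metis
  let ?L = "(\<lambda>s. 2 * s / \<sigma>\<^sup>2) ` R"
  have card: "card ?L = card T" using R assms card_gauss_exponents[of \<sigma> R] by simp
  have "card T > 0" using assms by (auto simp: card_gt_0_iff)
  then obtain c where nontriv: "\<exists>l\<in>?L. c l \<noteq> 0"
    and simple: "\<And>z. z \<in> T - {r} \<Longrightarrow> vanishes_to_order ?L c z 1"
    using exp_sum_with_prescribed_zeros[of ?L "T - {r}" "\<lambda>_. 1"] R assms card by auto
  have "exp_sum ?L c r \<noteq> 0"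
  proof
    assume "exp_sum ?L c r = 0"
    then have "(\<Sum>z\<in>T. 1) < card ?L"
      using R assms nontriv simple
      by (intro exp_sum_zero_count[where c = c]) (auto simp: vanishes_to_order_def)
    then show False using card by simp
  qed
  moreover have "exp_sum ?L c u = 0" if "u \<in> T" "u \<noteq> r" for u
    using simple that by (auto simp: vanishes_to_order_def)
  moreover
  let ?b = "\<lambda>s. if s \<in> R then c (2 * s / \<sigma>\<^sup>2) * exp (s\<^sup>2 / \<sigma>\<^sup>2) else 0"
  have "(\<Sum>s\<in>S. ?b s * gauss_kernel \<sigma> s u) = exp (- u\<^sup>2 / \<sigma>\<^sup>2) * exp_sum ?L c u" for u
    unfolding exp_sum_eq_gauss_sum[OF assms(1), symmetric]
    using R assms(2) by (intro sum.mono_neutral_cong_right) auto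
  ultimately show thesis by (intro that[of ?b]) auto
qed

section \<open>Measures with finite support\<close>

lemma gauss_kernel_measurable:
  assumes "sets z = sets borel_I"
  shows "gauss_kernel \<sigma> s \<in> borel_measurable z"
proof -
  have "gauss_kernel \<sigma> s \<in> borel_measurable borel"
    unfolding gauss_kernel_def by measurable
  then have "gauss_kernel \<sigma> s \<in> borel_measurable borel_I"
    by (rule measurable_restrict_space1)
  then show ?thesis unfolding measurable_cong_sets[OF assms refl] .
qed

lemma singleton_in_borel_I: "u \<in> {0..1} \<Longrightarrow> {u} \<in> sets borel_I"
  by (auto simp: sets_restrict_space_iff)

text \<open>Almost everywhere \<open>f\<close> agrees with a finite combination of indicators of singletons. This
  serves for kernels, to compare weights, and for indicators of Borel sets, to recover the measure
  from its weights.\<close>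

lemma has_bochner_integral_finite_support:
  fixes f :: "real \<Rightarrow> real" and T :: "real set"
  assumes z: "sets z = sets borel_I" "finite_measure z"
    and T: "finite T" "T \<subseteq> {0..1}" "AE u in z. u \<in> T"
    and f: "f \<in> borel_measurable z"
  shows "has_bochner_integral z f (\<Sum>r\<in>T. measure z {r} * f r)"
proof -
  interpret finite_measure z by fact
  have sing: "{r} \<in> sets z" if "r \<in> T" for r
    using singleton_in_borel_I that T z by auto
  have "has_bochner_integral z (indicat_real {r}) (measure z {r})" if "r \<in> T" for r
    using sing[OF that] by (intro has_bochner_integral_real_indicator) (auto simp: emeasure_eq_measure)
  then have sum: "has_bochner_integral z (\<lambda>u. \<Sum>r\<in>T. indicat_real {r} u * f r)
      (\<Sum>r\<in>T. measure z {r} * f r)"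
    by (intro has_bochner_integral_sum has_bochner_integral_mult_left) auto
  have "AE u in z. (\<Sum>r\<in>T. indicat_real {r} u * f r) = f u"
    using T(3)
  proof eventually_elim
    case (elim u)
    then show ?case
      using T(1) by (subst sum.remove[of _ u]) (auto simp: indicator_def intro!: sum.neutral)
  qed
  with has_bochner_integral_cong_AE[OF borel_measurable_has_bochner_integral[OF sum] f this] sum
  show ?thesis by simp
qed

text \<open>On the unit interval the kernel is at least \<open>exp (- 1 / \<sigma>\<^sup>2)\<close>, so a single integrable kernel
  already bounds the total mass.\<close>

lemma finite_measure_if_gauss_integrable:
  assumes "sets z = sets borel_I" "integrable z (gauss_kernel \<sigma> s)" "\<sigma> > 0" "s \<in> {0..1}"
  shows "finite_measure z"
proof -
  have sp: "space z = {0..1}"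
    using sets_eq_imp_space_eq[OF assms(1)] by (simp add: space_restrict_space)
  have "integrable z (\<lambda>u. exp (1 / \<sigma>\<^sup>2) * gauss_kernel \<sigma> s u)" using assms by simp
  then have "integrable z (\<lambda>u. 1 :: real)"
  proof (rule Bochner_Integration.integrable_bound)
    show "AE u in z. norm (1::real) \<le> norm (exp (1 / \<sigma>\<^sup>2) * gauss_kernel \<sigma> s u)"
    proof (rule AE_I2)
      fix u assume "u \<in> space z"
      then have "\<bar>u - s\<bar> \<le> 1" using sp assms by auto
      then have "(u - s)\<^sup>2 \<le> 1" by (simp add: abs_square_le_1)
      then have "exp (1 / \<sigma>\<^sup>2 + - (u - s)\<^sup>2 / \<sigma>\<^sup>2) \<ge> 1"
        unfolding one_le_exp_iff using assms by (simp add: field_simps)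
      then show "norm (1::real) \<le> norm (exp (1 / \<sigma>\<^sup>2) * gauss_kernel \<sigma> s u)"
        by (simp only: gauss_kernel_def exp_add) simp
    qed
  qed simp
  then show ?thesis by (intro finite_measureI) (auto simp: integrable_iff_bounded)
qed

lemma finite_support_measures_eqI:
  fixes T :: "real set"
  assumes z: "sets z = sets borel_I" "finite_measure z" "AE u in z. u \<in> T"
    and x: "sets x = sets borel_I" "finite_measure x" "AE u in x. u \<in> T"
    and T: "finite T" "T \<subseteq> {0..1}"
    and eq: "\<And>r. r \<in> T \<Longrightarrow> measure z {r} = measure x {r}"
  shows "z = x"
proof (rule measure_eqI)
  show "sets z = sets x" using z x by simp
  fix A assume A: "A \<in> sets z"
  have val: "emeasure w A = ennreal (\<Sum>r\<in>T. measure w {r} * indicator A r)"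
    if w: "sets w = sets borel_I" "finite_measure w" "AE u in w. u \<in> T" for w
  proof -
    interpret finite_measure w by fact
    have A': "A \<in> sets w" using A w z by simp
    then have "has_bochner_integral w (indicator A) (\<Sum>r\<in>T. measure w {r} * indicator A r)"
      using w T by (intro has_bochner_integral_finite_support) auto
    moreover have "has_bochner_integral w (indicator A :: _ \<Rightarrow> real) (measure w A)"
      using A' by (intro has_bochner_integral_real_indicator) (auto simp: emeasure_eq_measure)
    ultimately show ?thesis
      using has_bochner_integral_eq by (metis emeasure_eq_measure)
  qed
  show "emeasure z A = emeasure x A"
    unfolding val[OF z] val[OF x] using eq by simp
qed

lemma finite_measure_discrete_measure: "finite_measure (discrete_measure k a t)"
proof (rule finite_measureI)
  have "{0..1::real} \<in> sets borel_I" by (simp add: sets_restrict_space_iff)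
  then show "emeasure (discrete_measure k a t) (space (discrete_measure k a t)) \<noteq> \<infinity>"
    by (simp add: emeasure_discrete_measure ennreal_mult_eq_top_iff)
qed

lemma AE_discrete_measure:
  assumes "\<And>i. i \<in> {1..k} \<Longrightarrow> t i \<in> {0..1}"
  shows "AE u in discrete_measure k a t. u \<in> t ` {1..k}"
proof (rule AE_I)
  let ?N = "{0..1} - t ` {1..k}"
  have "closed (t ` {1..k})" by (intro finite_imp_closed) auto
  then have N: "?N \<in> sets borel_I" by (auto simp: sets_restrict_space_iff)
  then show "?N \<in> sets (discrete_measure k a t)" by simp
  show "emeasure (discrete_measure k a t) ?N = 0"
    using N by (simp add: emeasure_discrete_measure)
qed auto

text \<open>The certificate confines \<open>z\<close> to \<open>T\<close>: a non-negative function with integral 0 vanishes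
  almost everywhere, and its zeros are the points of \<open>T\<close>. The separating combinations then
  read off each weight from the measurements.\<close>

theorem nonneg_measure_unique_from_gauss_integrals:
  fixes S T :: "real set"
  assumes "\<sigma> > 0" and S: "finite S" "S \<subseteq> {0..1}" "card S \<ge> 2 * card T + 1"
    and T: "finite T" "T \<subseteq> {0..1}"
    and x: "sets x = sets borel_I" "AE u in x. u \<in> T"
      "\<And>s. s \<in> S \<Longrightarrow> has_bochner_integral x (gauss_kernel \<sigma> s) (y s)"
    and z: "sets z = sets borel_I"
      "\<And>s. s \<in> S \<Longrightarrow> has_bochner_integral z (gauss_kernel \<sigma> s) (y s)"
  shows "z = x"
proof -
  have "S \<noteq> {}" using S by auto
  then obtain s0 where s0: "s0 \<in> S" by blast
  have fin: "finite_measure z" "finite_measure x"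
    using finite_measure_if_gauss_integrable[of _ \<sigma> s0] s0 S x z assms(1)
    by (auto simp: has_bochner_integral_iff)
  have comb: "has_bochner_integral w (\<lambda>u. \<Sum>s\<in>S. b s * gauss_kernel \<sigma> s u) (\<Sum>s\<in>S. b s * y s)"
    if "\<And>s. s \<in> S \<Longrightarrow> has_bochner_integral w (gauss_kernel \<sigma> s) (y s)" for w b
    using that by (intro has_bochner_integral_sum has_bochner_integral_mult_right) auto
  obtain b where b: "\<And>u. (\<Sum>s\<in>S. b s * gauss_kernel \<sigma> s u) \<ge> 0"
    "\<And>u. (\<Sum>s\<in>S. b s * gauss_kernel \<sigma> s u) = 0 \<longleftrightarrow> u \<in> T"
    using gauss_certificate[OF assms(1) S(1) T(1) S(3)] by blast
  let ?F = "\<lambda>u. \<Sum>s\<in>S. b s * gauss_kernel \<sigma> s u"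
  have "AE u in x. ?F u = 0" using x(2) b(2) by auto
  then have "(LINT u|x. ?F u) = 0" by (rule integral_eq_zero_AE)
  then have "(\<Sum>s\<in>S. b s * y s) = 0"
    using comb[OF x(3), of b] by (simp add: has_bochner_integral_iff)
  then have "integrable z ?F" "(LINT u|z. ?F u) = 0"
    using comb[OF z(2), of b] by (auto simp: has_bochner_integral_iff)
  then have "AE u in z. ?F u = 0"
    using integral_nonneg_eq_0_iff_AE[of z ?F] b(1) by simp
  then have supp: "AE u in z. u \<in> T" using b(2) by simp
  have "measure z {r} = measure x {r}" if r: "r \<in> T" for r
  proof -
    obtain g where g: "\<And>u. u \<in> T \<Longrightarrow> (\<Sum>s\<in>S. g s * gauss_kernel \<sigma> s u) = 0 \<longleftrightarrow> u \<noteq> r"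
      using gauss_separates_points[OF assms(1) S(1) T(1) _ r] S(3) by auto
    let ?G = "\<lambda>u. \<Sum>s\<in>S. g s * gauss_kernel \<sigma> s u"
    have weight: "measure w {r} * ?G r = (\<Sum>s\<in>S. g s * y s)"
      if w: "sets w = sets borel_I" "finite_measure w" "AE u in w. u \<in> T"
        "\<And>s. s \<in> S \<Longrightarrow> has_bochner_integral w (gauss_kernel \<sigma> s) (y s)" for w
    proof -
      note c = comb[OF w(4), of g]
      have "has_bochner_integral w ?G (\<Sum>q\<in>T. measure w {q} * ?G q)"
        using w T borel_measurable_has_bochner_integral[OF c]
        by (intro has_bochner_integral_finite_support) auto
      then have "(\<Sum>s\<in>S. g s * y s) = (\<Sum>q\<in>T. measure w {q} * ?G q)"
        using c has_bochner_integral_eq by blast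
      also have "\<dots> = measure w {r} * ?G r"
        using T(1) r g by (subst sum.remove[of _ r]) (auto intro!: sum.neutral)
      finally show ?thesis by simp
    qed
    have "measure z {r} * ?G r = measure x {r} * ?G r"
      using weight[OF z(1) fin(1) supp z(2)] weight[OF x(1) fin(2) x(2,3)] by simp
    then show ?thesis using g[OF r] by simp
  qed
  then show ?thesis
    using finite_support_measures_eqI[OF z(1) fin(1) supp x(1) fin(2) x(2) T] by blast
qed

theorem proposition3:
  fixes k m :: nat and a t s y :: "nat \<Rightarrow> real" and \<sigma> :: real and x :: "real measure"
  assumes "\<And>i. i \<in> {1..k} \<Longrightarrow> a i > 0"
    and "\<And>i. i \<in> {1..k} \<Longrightarrow> t i \<in> {0<..<1}"
    and "inj_on t {1..k}"
    and "x = discrete_measure k a t"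
    and "\<sigma> > 0"
    and "m \<ge> 2 * k + 1"
    and "\<And>j. j \<in> {1..m} \<Longrightarrow> s j \<in> {0..1}"
    and "strict_mono_on {1..m} s"
    and "\<And>j. j \<in> {1..m} \<Longrightarrow> y j = (LINT u|x. gauss_kernel \<sigma> (s j) u)"
  shows "fits_measurements \<sigma> m s y x \<and> (\<forall>z. fits_measurements \<sigma> m s y z \<longrightarrow> z = x)"
proof -
  let ?T = "t ` {1..k}" and ?S = "s ` {1..m}"
  have T: "finite ?T" "?T \<subseteq> {0..1}" using assms(2) by force+
  have sets_x: "sets x = sets borel_I" and fin: "finite_measure x"
    using assms(4) finite_measure_discrete_measure by auto
  have supp: "AE u in x. u \<in> ?T"
    unfolding assms(4) using assms(2) by (intro AE_discrete_measure) force
  have fits: "fits_measurements \<sigma> m s y x"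
    unfolding fits_measurements_def
  proof (intro conjI ballI)
    fix j assume j: "j \<in> {1..m}"
    have "integrable x (gauss_kernel \<sigma> (s j))"
      using has_bochner_integral_finite_support[OF sets_x fin T supp gauss_kernel_measurable[OF sets_x]]
      by (auto simp: has_bochner_integral_iff)
    then show "has_bochner_integral x (gauss_kernel \<sigma> (s j)) (y j)"
      using assms(9)[OF j] by (simp add: has_bochner_integral_iff)
  qed (rule sets_x)
  have inj: "inj_on s {1..m}" using assms(8) by (rule strict_mono_on_imp_inj_on)
  have card: "card ?S \<ge> 2 * card ?T + 1"
    using card_image[OF inj] card_image[OF assms(3)] assms(6) by simp
  have "z = x" if z: "fits_measurements \<sigma> m s y z" for z
  proof (rule nonneg_measure_unique_from_gauss_integrals[OF assms(5) _ _ card T sets_x supp])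
    \<comment> \<open>Measurements indexed by centres instead of by their numbers.\<close>
    let ?y = "\<lambda>q. y (the_inv_into {1..m} s q)"
    show "finite ?S" "?S \<subseteq> {0..1}" using assms(7) by auto
    show "has_bochner_integral x (gauss_kernel \<sigma> q) (?y q)" if "q \<in> ?S" for q
      using that fits inj by (auto simp: fits_measurements_def the_inv_into_f_f)
    show "sets z = sets borel_I" using z by (simp add: fits_measurements_def)
    show "has_bochner_integral z (gauss_kernel \<sigma> q) (?y q)" if "q \<in> ?S" for q
      using that z inj by (auto simp: fits_measurements_def the_inv_into_f_f)
  qed
  with fits show ?thesis by blast
qed

end
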